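(* Let $u\in\Lambda$. Then $R^s_u\neq\emptyset$ if and only if there exists $(h,\beta)\in\Gamma^{\mathrm{dec}}_{\mathrm{ev}}(u)$ which is usefully decreasing.
   Context: $\mathbb N=\{0,1,2,\dots\}$. $\Lambda$ is the set of real sequences $u=(u_k)_{k\in\mathbb N}$ with $\sup_{n}u_n<+\infty$. For $u\in\mathbb R^{\mathbb N}$, $R^s_u:=\{k\in\mathbb N: u_k>\limsup_{n\to+\infty}u_n\}$ (the limsup may be $-\infty$). $\Omega([0,1])$ is the set of functions $f:\mathbb R\to\mathbb R$ that are strictly increasing and continuous on $[0,1]$. Set $\Gamma(u):=\{(h,\beta)\in\Omega([0,1])^{\mathbb N}\times(0,1)^{\mathbb N}: u_k\le h_k(\beta_k^k)\ \forall k\in\mathbb N\}$, where $\beta_k^k$ is the $k$-th power of $\beta_k$. For $f,g\in\Omega([0,1])$, $f\le g$ means $f(x)\le g(x)$ for all $x\in[0,1]$; $(f,\beta)\le(g,\gamma)$ on $\Omega([0,1])\times(0,1)$ means $f\le g$ and $\beta\le\gamma$. $\Gamma^{\mathrm{dec}}_{\mathrm{ev}}(u)$ is the set of $(h,\beta)\in\Gamma(u)$ for which there is $N\in\mathbb N$ with $(h_{n+1},\beta_{n+1})\le(h_n,\beta_n)$ for all $n\ge N$; $\mathfrak m(h,\beta)$ denotes the smallest such $N$. Let $\mathcal S(u,h):=\{k\in\mathbb N: u_k>h_k(0)\}$. A pair $(h,\beta)\in\Gamma^{\mathrm{dec}}_{\mathrm{ev}}(u)$ is usefully decreasing if $\mathcal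 S(u,h)\cap[\mathfrak m(h,\beta),+\infty)\neq\emptyset$. *)

theory Defs
  imports "HOL-Analysis.Analysis"
begin

definition bounded_above_seqs :: "(nat \<Rightarrow> real) set" where
  "bounded_above_seqs = {u. (SUP n. ereal (u n)) < \<infinity>}"

text \<open>The limit superior is taken in the extended reals, so that it may be \<open>-\<infinity>\<close>.\<close>

definition R_s :: "(nat \<Rightarrow> real) \<Rightarrow> nat set" where
  "R_s u = {k. ereal (u k) > limsup (\<lambda>n. ereal (u n))}"

definition Omega01 :: "(real \<Rightarrow> real) set" where
  "Omega01 = {f. strict_mono_on {0..1} f \<and> continuous_on {0..1} f}"

definition Gamma_set :: "(nat \<Rightarrow> real) \<Rightarrow> ((nat \<Rightarrow> real \<Rightarrow> real) \<times> (nat \<Rightarrow> real)) set" where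
  "Gamma_set u = {(h, \<beta>). (\<forall>k. h k \<in> Omega01) \<and> (\<forall>k. \<beta> k \<in> {0<..<1}) \<and>
                          (\<forall>k. u k \<le> h k (\<beta> k ^ k))}"

text \<open>Elements of \<open>Omega01\<close> are total functions on the reals, but they are compared
  on the unit interval only; hence the library order on functions is not used.\<close>

definition le01 :: "(real \<Rightarrow> real) \<Rightarrow> (real \<Rightarrow> real) \<Rightarrow> bool" where
  "le01 f g \<longleftrightarrow> (\<forall>x\<in>{0..1}. f x \<le> g x)"

definition le_pair :: "(real \<Rightarrow> real) \<times> real \<Rightarrow> (real \<Rightarrow> real) \<times> real \<Rightarrow> bool" where
  "le_pair p q \<longleftrightarrow> le01 (fst p) (fst q) \<and> snd p \<le> snd q"

definition decreasing_from :: "(nat \<Rightarrow> real \<Rightarrow> real) \<Rightarrow> (nat \<Rightarrow> real) \<Rightarrow> nat \<Rightarrow> bool" where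
  "decreasing_from h \<beta> N \<longleftrightarrow> (\<forall>n\<ge>N. le_pair (h (Suc n), \<beta> (Suc n)) (h n, \<beta> n))"

definition Gamma_dec_ev :: "(nat \<Rightarrow> real) \<Rightarrow> ((nat \<Rightarrow> real \<Rightarrow> real) \<times> (nat \<Rightarrow> real)) set" where
  "Gamma_dec_ev u = {(h, \<beta>). (h, \<beta>) \<in> Gamma_set u \<and> (\<exists>N. decreasing_from h \<beta> N)}"

text \<open>Only meaningful for eventually decreasing pairs, as \<open>LEAST\<close> is unspecified otherwise.\<close>

definition dec_index :: "(nat \<Rightarrow> real \<Rightarrow> real) \<Rightarrow> (nat \<Rightarrow> real) \<Rightarrow> nat" where
  "dec_index h \<beta> = (LEAST N. decreasing_from h \<beta> N)"

definition S_set :: "(nat \<Rightarrow> real) \<Rightarrow> (nat \<Rightarrow> real \<Rightarrow> real) \<Rightarrow> nat set" where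
  "S_set u h = {k. u k > h k 0}"

definition usefully_decreasing ::
  "(nat \<Rightarrow> real) \<Rightarrow> (nat \<Rightarrow> real \<Rightarrow> real) \<Rightarrow> (nat \<Rightarrow> real) \<Rightarrow> bool" where
  "usefully_decreasing u h \<beta> \<longleftrightarrow> S_set u h \<inter> {dec_index h \<beta>..} \<noteq> {}"

end

theory Submission
  imports Defs
begin

text \<open>
  If \<open>limsup u < c < u k\<close>, then only finitely many terms of \<open>u\<close> exceed \<open>c\<close>, so for \<open>M\<close> large
  enough the constant sequences \<open>h n x = c + M * x\<close> and \<open>\<beta> n = 1/2\<close> form a usefully decreasing
  pair. Conversely, if \<open>(h, \<beta>)\<close> decreases from \<open>k\<close> on, then \<open>u n \<le> h n (\<beta> n ^ n) \<le> h k (\<beta> k ^ n)\<close>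
  for \<open>n \<ge> k\<close>, and the right-hand side tends to \<open>h k 0\<close>; hence \<open>limsup u \<le> h k 0\<close>.
\<close>

lemma decreasing_from_le_pair:
  assumes "decreasing_from h \<beta> N" "N \<le> k" "k \<le> n"
  shows "le_pair (h n, \<beta> n) (h k, \<beta> k)"
  using \<open>k \<le> n\<close>
proof (induction n rule: dec_induct)
  case base
  show ?case
    by (simp add: le_pair_def le01_def)
next
  case (step n)
  with assms have "le_pair (h (Suc n), \<beta> (Suc n)) (h n, \<beta> n)"
    by (simp add: decreasing_from_def)
  with step.IH show ?case
    unfolding le_pair_def le01_def by fastforce
qed

text \<open>Freezing the function and the base at index \<open>k\<close> while the exponent
  \<open>n\<close> keeps growing leaves a single continuous function evaluated along a null
  sequence.\<close>

lemma limsup_le_value_at_zero: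
  assumes \<Gamma>: "(h, \<beta>) \<in> Gamma_set u" and dec: "decreasing_from h \<beta> N" and "N \<le> k"
  shows "limsup (\<lambda>n. ereal (u n)) \<le> ereal (h k 0)"
proof -
  have \<beta>: "0 < \<beta> n" "\<beta> n < 1" and \<beta>_pow: "\<beta> n ^ m \<in> {0..1}" for n m
    using \<Gamma> by (auto simp: Gamma_set_def less_imp_le power_le_one)
  have mono: "strict_mono_on {0..1} (h k)" and cont: "continuous_on {0..1} (h k)"
    using \<Gamma> by (auto simp: Gamma_set_def Omega01_def)
  have "u n \<le> h k (\<beta> k ^ n)" if "k \<le> n" for n
  proof -
    have le: "le01 (h n) (h k)" "\<beta> n \<le> \<beta> k"
      using decreasing_from_le_pair[OF dec \<open>N \<le> k\<close> that] by (auto simp: le_pair_def)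
    have "u n \<le> h n (\<beta> n ^ n)"
      using \<Gamma> by (auto simp: Gamma_set_def)
    also have "\<dots> \<le> h k (\<beta> n ^ n)"
      using le(1) \<beta>_pow by (auto simp: le01_def)
    also have "\<dots> \<le> h k (\<beta> k ^ n)"
      using le(2) \<beta>(1)[of n]
      by (intro strict_mono_on_leD[OF mono] \<beta>_pow power_mono) auto
    finally show ?thesis .
  qed
  then have "\<forall>\<^sub>F n in sequentially. ereal (u n) \<le> ereal (h k (\<beta> k ^ n))"
    by (auto simp: eventually_sequentially)
  then have "limsup (\<lambda>n. ereal (u n)) \<le> limsup (\<lambda>n. ereal (h k (\<beta> k ^ n)))"
    by (rule Limsup_mono)
  also have "(\<lambda>n. \<beta> k ^ n) \<longlonglongrightarrow> 0"
    using \<beta>[of k] by (intro LIMSEQ_realpow_zero) auto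
  \<comment> \<open>Continuity is only known on \<open>{0..1}\<close>, so the powers must be seen to
    stay in that interval.\<close>
  then have "(\<lambda>n. h k (\<beta> k ^ n)) \<longlonglongrightarrow> h k 0"
    by (rule continuous_on_tendsto_compose[OF cont]) (use \<beta>_pow in auto)
  then have "limsup (\<lambda>n. ereal (h k (\<beta> k ^ n))) = ereal (h k 0)"
    by (intro lim_imp_Limsup) auto
  finally show ?thesis .
qed

lemma ex_affine_majorant:
  fixes u :: "nat \<Rightarrow> real"
  assumes "limsup (\<lambda>n. ereal (u n)) < ereal c"
  obtains M where "M > 0" "\<And>n. u n \<le> c + M * (1/2) ^ n"
proof -
  from Limsup_lessD[OF assms] obtain N where N: "\<And>n. N \<le> n \<Longrightarrow> u n < c"
    by (auto simp: eventually_sequentially)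
  \<comment> \<open>The weight \<open>2 ^ n\<close> cancels \<open>(1/2) ^ n\<close>, and the sum
    dominates each of its terms. The summand 1 keeps \<open>M\<close> positive even if the sum
    vanishes; a positive slope makes the affine map strictly increasing.\<close>
  define M where "M = 1 + (\<Sum>n<N. 2 ^ n * \<bar>u n - c\<bar>)"
  have "M > 0"
    unfolding M_def by (intro add_pos_nonneg sum_nonneg) auto
  moreover have "u n \<le> c + M * (1/2) ^ n" for n
  proof (cases "n < N")
    case True
    then have "2 ^ n * \<bar>u n - c\<bar> \<le> (\<Sum>n<N. 2 ^ n * \<bar>u n - c\<bar>)"
      by (intro member_le_sum) auto
    then have "2 ^ n * \<bar>u n - c\<bar> \<le> M"
      by (simp add: M_def)
    then have "\<bar>u n - c\<bar> \<le> M * (1/2) ^ n"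
      by (simp add: field_simps)
    then show ?thesis
      by linarith
  next
    case False
    have "u n < c"
      using N False by simp
    moreover have "0 \<le> M * (1/2) ^ n"
      using \<open>M > 0\<close> by simp
    ultimately show ?thesis
      by linarith
  qed
  ultimately show thesis
    by (rule that)
qed

theorem theorem2:
  fixes u :: "nat \<Rightarrow> real"
  assumes "u \<in> bounded_above_seqs"
  shows "R_s u \<noteq> {} \<longleftrightarrow> (\<exists>(h, \<beta>) \<in> Gamma_dec_ev u. usefully_decreasing u h \<beta>)"
proof
  assume "R_s u \<noteq> {}"
  then obtain k where "limsup (\<lambda>n. ereal (u n)) < ereal (u k)"
    by (auto simp: R_s_def)
  \<comment> \<open>\<open>c\<close> will be the common value \<open>h n 0\<close>: the upper bound
    puts \<open>k\<close> into \<open>S_set u h\<close>, the lower one allows the affine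
    majorant.\<close>
  then obtain c where c: "limsup (\<lambda>n. ereal (u n)) < ereal c" "c < u k"
    using ereal_dense2 by (metis ereal_less_eq(3) not_le)
  then obtain M where M: "M > 0" "\<And>n. u n \<le> c + M * (1/2) ^ n"
    using ex_affine_majorant by blast
  define h where "h = (\<lambda>(n::nat) x. c + M * x)"
  define \<beta> where "\<beta> = (\<lambda>n::nat. 1/2 :: real)"
  have "h n \<in> Omega01" for n
    using M(1) by (auto simp: h_def Omega01_def strict_mono_on_def intro!: continuous_intros)
  with M(2) have \<Gamma>: "(h, \<beta>) \<in> Gamma_set u"
    by (auto simp: Gamma_set_def h_def \<beta>_def)
  have dec: "decreasing_from h \<beta> 0"
    by (simp add: decreasing_from_def le_pair_def le01_def h_def \<beta>_def)
  \<comment> \<open>With index 0, every element of \<open>S_set u h\<close> is late enough.\<close>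
  have "dec_index h \<beta> = 0"
    unfolding dec_index_def using dec by (rule Least_eq_0)
  with c(2) have "usefully_decreasing u h \<beta>"
    by (auto simp: usefully_decreasing_def S_set_def h_def)
  with \<Gamma> dec show "\<exists>(h, \<beta>) \<in> Gamma_dec_ev u. usefully_decreasing u h \<beta>"
    by (auto simp: Gamma_dec_ev_def)
next
  assume "\<exists>(h, \<beta>) \<in> Gamma_dec_ev u. usefully_decreasing u h \<beta>"
  then obtain h \<beta> k where \<Gamma>: "(h, \<beta>) \<in> Gamma_set u" and "\<exists>N. decreasing_from h \<beta> N"
    and k: "h k 0 < u k" "dec_index h \<beta> \<le> k"
    by (auto simp: Gamma_dec_ev_def usefully_decreasing_def S_set_def)
  \<comment> \<open>Some \<open>N\<close> exists, so the \<open>LEAST\<close> in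
    \<open>dec_index\<close> is attained.\<close>
  then have "decreasing_from h \<beta> (dec_index h \<beta>)"
    unfolding dec_index_def by (auto intro: LeastI_ex)
  from limsup_le_value_at_zero[OF \<Gamma> this k(2)]
  have "limsup (\<lambda>n. ereal (u n)) < ereal (u k)"
    using k(1) by (simp add: le_less_trans)
  then show "R_s u \<noteq> {}"
    by (auto simp: R_s_def)
qed

end
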